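(* Let $X$ be a submetrizable topological space. Let $Y$ be a functionally Hausdorff, dense-in-itself topological space such that for every $y\in Y$ there exists a subset $Q(y)\subseteq Y$ such that $y\in Q(y)$ and $y$ is a non-isolated q-point of the subspace $Q(y)$. Let $f\colon X\to Y$ be a continuous surjective map that is both open and closed. Then $Y$ is submetrizable.
   Context: A topological space $X$ is submetrizable if there is a topology on the set $X$, contained in the topology of $X$, which is metrizable. A space $Y$ is functionally Hausdorff if for any distinct $x,y\in Y$ there is a continuous $h\colon Y\to[0,1]$ with $h(x)=0$ and $h(y)=1$. A space is dense-in-itself if it has no isolated points. A point $x$ of a space $Z$ is a q-point of $Z$ if there is a sequence $(U_i)_{i\in\omega}$ of open neighbourhoods of $x$ in $Z$ such that, whenever $x_i\in U_i$ for all $i$ and the $x_i$ are all distinct, the set $\{x_i : i\in\omega\}$ has an accumulation point in $Z$. Here $Q(y)$ carries the subspace topology from $Y$. A map is open (closed) if it sends open sets to open sets (closed sets to closed sets). *)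

theory Defs
  imports "HOL-Analysis.Analysis"
begin

definition submetrizable_space :: "'a topology \<Rightarrow> bool" where
  "submetrizable_space X \<longleftrightarrow>
     (\<exists>T. topspace T = topspace X \<and> (\<forall>U. openin T U \<longrightarrow> openin X U) \<and> metrizable_space T)"

definition functionally_Hausdorff_space :: "'a topology \<Rightarrow> bool" where
  "functionally_Hausdorff_space Y \<longleftrightarrow>
     (\<forall>x \<in> topspace Y. \<forall>y \<in> topspace Y. x \<noteq> y \<longrightarrow>
        (\<exists>h. continuous_map Y (top_of_set {0..1::real}) h \<and> h x = 0 \<and> h y = 1))"

definition isolated_point_of :: "'a \<Rightarrow> 'a topology \<Rightarrow> bool" where
  "isolated_point_of x Z \<longleftrightarrow> openin Z {x}"

definition dense_in_itself_space :: "'a topology \<Rightarrow> bool" where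
  "dense_in_itself_space Y \<longleftrightarrow> (\<forall>y \<in> topspace Y. \<not> isolated_point_of y Y)"

definition q_point_of :: "'a \<Rightarrow> 'a topology \<Rightarrow> bool" where
  "q_point_of x Z \<longleftrightarrow>
     x \<in> topspace Z \<and>
     (\<exists>U :: nat \<Rightarrow> 'a set.
        (\<forall>i. openin Z (U i) \<and> x \<in> U i) \<and>
        (\<forall>s :: nat \<Rightarrow> 'a. (\<forall>i. s i \<in> U i) \<and> inj s \<longrightarrow> Z derived_set_of (range s) \<noteq> {}))"

end

(* Fix a bounded metric d inducing a coarser topology on X. A locally finite sequence of open sets
   of X cannot meet a fibre of f in each of its members, because the fibre lies over a non-isolated
   q-point. Applied to small balls around an e-separated sequence this makes fibres totally bounded
   for d; applied to the sets {d(x,-) + h o f < 1/(n+1)}, where h separates the base point from f(x),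
   it makes them closed for d. The Hausdorff distance between fibres is then a metric on Y, and it is
   continuous because f is open and closed. *)
theory Submission
  imports Defs
begin

section \<open>Open level sets, T1 separation and injective choice\<close>

lemma continuous_map_openin_Collect_less:
  assumes "continuous_map X euclideanreal g"
  shows "openin X {x \<in> topspace X. g x < c}"
proof -
  have "{x \<in> topspace X. g x < c} = {x \<in> topspace X. g x \<in> {..<c}}"
    by auto
  then show ?thesis
    using openin_continuous_map_preimage[OF assms, of "{..<c}"] by simp
qed

lemma continuous_map_openin_Collect_greater:
  assumes "continuous_map X euclideanreal g"
  shows "openin X {x \<in> topspace X. c < g x}"
proof -
  have "{x \<in> topspace X. c < g x} = {x \<in> topspace X. g x \<in> {c<..}}"
    by auto
  then show ?thesis
    using openin_continuous_map_preimage[OF assms, of "{c<..}"] by simp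
qed

lemma submetrizable_imp_t1_space:
  assumes "submetrizable_space X"
  shows "t1_space X"
  using assms unfolding submetrizable_space_def
  by (metis metrizable_imp_t1_space t1_space_expansive)

lemma functionally_Hausdorff_imp_t1_space:
  assumes "functionally_Hausdorff_space Y"
  shows "t1_space Y"
  unfolding t1_space_def
proof (intro ballI impI)
  fix x y
  assume x: "x \<in> topspace Y" and y: "y \<in> topspace Y" and "x \<noteq> y"
  then obtain h where h: "continuous_map Y euclideanreal h" "h x = 0" "h y = 1"
    using assms unfolding functionally_Hausdorff_space_def continuous_map_in_subtopology by metis
  then have "openin Y {z \<in> topspace Y. h z < 1}"
    by (intro continuous_map_openin_Collect_less)
  then show "\<exists>U. openin Y U \<and> x \<in> U \<and> y \<notin> U"
    using h x by (intro exI[of _ "{z \<in> topspace Y. h z < 1}"]) auto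
qed

text \<open>Removing the finitely many values already used from the infinite set \<open>A n\<close>
  leaves a fresh element at every stage. This supplies the distinct points that the q-point property
  asks for.\<close>

lemma ex_inj_choice:
  fixes A :: "nat \<Rightarrow> 'a set"
  assumes "\<And>n. infinite (A n)"
  obtains s where "inj s" "\<And>n. s n \<in> A n"
proof -
  have "\<exists>s. \<forall>n. s n \<in> A n \<and> s n \<notin> s ` {..<n}"
  proof (rule dependent_wellorder_choice[where P = "\<lambda>s n r. r \<in> A n \<and> r \<notin> s ` {..<n}"])
    fix f g :: "nat \<Rightarrow> 'a" and n r
    assume "\<And>m. m < n \<Longrightarrow> f m = g m"
    then have "f ` {..<n} = g ` {..<n}"
      by (intro image_cong) auto
    then show "(r \<in> A n \<and> r \<notin> f ` {..<n}) = (r \<in> A n \<and> r \<notin> g ` {..<n})"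
      by simp
  next
    fix n and f :: "nat \<Rightarrow> 'a"
    have "infinite (A n - f ` {..<n})"
      using assms by simp
    then have "A n - f ` {..<n} \<noteq> {}"
      by (metis finite.emptyI)
    then show "\<exists>r. r \<in> A n \<and> r \<notin> f ` {..<n}"
      by blast
  qed
  then obtain s where s: "\<And>n. s n \<in> A n" "\<And>n. s n \<notin> s ` {..<n}"
    by metis
  have "inj s"
  proof (rule linorder_injI)
    show "s m \<noteq> s n" if "m < n" for m n
      using s(2)[of n] that by (metis imageI lessThan_iff)
  qed
  with s(1) show thesis
    using that by blast
qed

section \<open>Locally finite sequences of open sets and fibres over q-points\<close>

text \<open>Michael's argument for closed maps: points of the \<open>V n\<close> chosen over distinct points near \<open>y\<close>
  form a closed discrete set, all of whose subsets have closed images, while the q-point property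
  makes the image accumulate.\<close>
lemma locally_finite_open_sequence_misses_fibre:
  fixes V :: "nat \<Rightarrow> 'a set"
  assumes t1: "t1_space X" "t1_space Y"
    and f: "open_map X Y f" "closed_map X Y f"
    and q: "q_point_of y (subtopology Y Q)" "\<not> isolated_point_of y (subtopology Y Q)"
    and V: "\<And>n. openin X (V n)"
    and lf: "\<And>x. x \<in> topspace X \<Longrightarrow> \<exists>W. openin X W \<and> x \<in> W \<and> finite {n. V n \<inter> W \<noteq> {}}"
  shows "\<exists>n. y \<notin> f ` V n"
proof (rule ccontr)
  assume "\<nexists>n. y \<notin> f ` V n"
  then have meets: "\<And>n. y \<in> f ` V n"
    by blast
  define Z where "Z = subtopology Y Q"
  obtain U where yZ: "y \<in> topspace Z" and U: "\<And>i. openin Z (U i)" "\<And>i. y \<in> U i"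
    and acc: "\<And>s::nat \<Rightarrow> _. (\<forall>i. s i \<in> U i) \<Longrightarrow> inj s \<Longrightarrow> Z derived_set_of (range s) \<noteq> {}"
    using q(1) unfolding q_point_of_def Z_def by metis
  have Z1: "t1_space Z"
    unfolding Z_def by (simp add: t1 t1_space_subtopology)
  \<comment> \<open>In a T1 space the other points of a finite open neighbourhood of
    \<open>y\<close> form a closed set; removing them would make \<open>{y}\<close> open, against
    non-isolatedness.\<close>
  have inf: "infinite G" if "openin Z G" "y \<in> G" for G
  proof
    assume "finite G"
    moreover have "G \<subseteq> topspace Z"
      using that(1) by (rule openin_subset)
    ultimately have "closedin Z (G - {y})"
      using Z1 by (simp add: t1_space_closedin_finite subset_insertI2 subset_iff)
    then have "openin Z (G - (G - {y}))"
      using that by (intro openin_diff)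
    moreover have "G - (G - {y}) = {y}"
      using that by auto
    ultimately show False
      using q(2) unfolding isolated_point_of_def Z_def by simp
  qed
  have "infinite (f ` V n \<inter> U n)" for n
  proof (rule inf)
    have "openin Y (f ` V n)"
      using f V open_map_def by blast
    then have "openin Z (f ` V n \<inter> Q)"
      unfolding Z_def by (simp add: openin_subtopology_Int)
    then have "openin Z ((f ` V n \<inter> Q) \<inter> U n)"
      using U by blast
    moreover have "(f ` V n \<inter> Q) \<inter> U n = f ` V n \<inter> U n"
      using openin_subset[OF U(1)[of n]] unfolding Z_def by auto
    ultimately show "openin Z (f ` V n \<inter> U n)"
      by simp
    show "y \<in> f ` V n \<inter> U n"
      using meets U by blast
  qed
  then obtain s where s: "inj s" "\<And>n. s n \<in> f ` V n \<inter> U n"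
    using ex_inj_choice[of "\<lambda>n. f ` V n \<inter> U n"] by blast
  have "\<exists>z. z \<in> V n \<and> f z = s n" for n
    using s(2)[of n] by auto
  then obtain z where z: "\<And>n. z n \<in> V n" "\<And>n. f (z n) = s n"
    by metis
  have zX: "z n \<in> topspace X" for n
    using z V openin_subset by blast
  \<comment> \<open>A point \<open>x\<close> outside the set has a neighbourhood \<open>W\<close>
    that meets only finitely many \<open>V n\<close>, hence contains only finitely many of the
    chosen points; deleting these keeps it open by T1. Arbitrary index sets \<open>N\<close> are
    treated because the last step deletes every index with value \<open>p\<close>.\<close>
  have clz: "closedin X (z ` N)" for N
    unfolding closedin_def
  proof
    show "z ` N \<subseteq> topspace X"
      using zX by blast
    show "openin X (topspace X - z ` N)"
    proof (subst openin_subopen, intro ballI)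
      fix x
      assume x: "x \<in> topspace X - z ` N"
      then obtain W where W: "openin X W" "x \<in> W" "finite {n. V n \<inter> W \<noteq> {}}"
        using lf by blast
      define E where "E = z ` ({n. V n \<inter> W \<noteq> {}} \<inter> N)"
      have "finite E" "E \<subseteq> topspace X"
        using W(3) zX unfolding E_def by auto
      then have "closedin X E"
        using t1(1) by (simp add: t1_space_closedin_finite)
      then have "openin X (W - E)"
        using W by blast
      moreover have "x \<in> W - E"
        using x W unfolding E_def by blast
      moreover have "W - E \<subseteq> topspace X - z ` N"
        using openin_subset[OF W(1)] z(1) unfolding E_def by auto
      ultimately show "\<exists>T. openin X T \<and> x \<in> T \<and> T \<subseteq> topspace X - z ` N"
        by blast
    qed
  qed
  have cls: "closedin Y (s ` N)" for N
  proof -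
    have "s ` N = f ` (z ` N)"
      using z(2) by (auto simp: image_iff)
    then show ?thesis
      using clz f closed_map_def by metis
  qed
  obtain p where p: "p \<in> Z derived_set_of (range s)"
    using acc s by blast
  then have pZ: "p \<in> topspace Z"
    by (simp add: in_derived_set_of)
  \<comment> \<open>The complement of this closed set is a neighbourhood of \<open>p\<close> that
    contains no value of \<open>s\<close> other than possibly \<open>p\<close> itself, so
    \<open>p\<close> cannot be an accumulation point.\<close>
  have "closedin Y (s ` {n. s n \<noteq> p})"
    by (rule cls)
  then have "openin Z (topspace Z - s ` {n. s n \<noteq> p})"
    unfolding Z_def openin_subtopology topspace_subtopology
    by (intro exI[of _ "topspace Y - s ` {n. s n \<noteq> p}"]) auto
  moreover have "p \<in> topspace Z - s ` {n. s n \<noteq> p}"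
    using pZ by auto
  ultimately show False
    using p unfolding in_derived_set_of by blast
qed

section \<open>Continuity of the distance and failure of total boundedness\<close>

context Metric_space
begin

lemma continuous_map_dist:
  assumes "x \<in> M"
  shows "continuous_map mtopology euclideanreal (d x)"
proof -
  have "openin mtopology {z \<in> M. d x z \<in> U}" if "open U" for U
    unfolding openin_mtopology
  proof (intro conjI allI impI)
    fix z
    assume z: "z \<in> {z \<in> M. d x z \<in> U}"
    then obtain e where e: "e > 0" "\<And>t. dist t (d x z) < e \<Longrightarrow> t \<in> U"
      using \<open>open U\<close> unfolding open_dist by blast
    have "mball z e \<subseteq> {z \<in> M. d x z \<in> U}"
    proof
      fix w
      assume w: "w \<in> mball z e"
      then have "dist (d x w) (d x z) < e"
        using triangle[of x z w] triangle'[of x w z] commute[of z w] z assms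
        by (simp add: dist_real_def abs_less_iff)
      then show "w \<in> {z \<in> M. d x z \<in> U}"
        using e w by simp
    qed
    with e(1) show "\<exists>r>0. mball z r \<subseteq> {z \<in> M. d x z \<in> U}"
      by blast
  qed auto
  then show ?thesis
    by (simp add: continuous_map_def)
qed

text \<open>Greedy choice: for some \<open>e\<close> the \<open>e\<close>-balls around the finitely
  many points chosen so far never cover \<open>S\<close>, so the next point can be taken outside all
  of them.\<close>

lemma not_mtotally_bounded_imp_separated_sequence:
  assumes "S \<subseteq> M" "\<not> mtotally_bounded S"
  obtains e and s :: "nat \<Rightarrow> 'a"
  where "e > 0" "range s \<subseteq> S" "\<And>m n. m \<noteq> n \<Longrightarrow> e \<le> d (s m) (s n)"
proof -
  obtain e where e: "e > 0" and K: "\<And>K. finite K \<Longrightarrow> K \<subseteq> S \<Longrightarrow> \<not> S \<subseteq> (\<Union>x\<in>K. mball x e)"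
    using assms unfolding mtotally_bounded_def by metis
  have "\<exists>s. \<forall>n::nat. s n \<in> S \<and> (\<forall>m<n. e \<le> d (s m) (s n))"
  proof (rule dependent_wellorder_choice[where P = "\<lambda>s n r. r \<in> S \<and> (\<forall>m<n. e \<le> d (s m) r)"])
    fix n and f :: "nat \<Rightarrow> 'a"
    assume "\<And>m. m < n \<Longrightarrow> f m \<in> S \<and> (\<forall>k<m. e \<le> d (f k) (f m))"
    then have sub: "f ` {..<n} \<subseteq> S"
      by auto
    then have "\<not> S \<subseteq> (\<Union>x\<in>f ` {..<n}. mball x e)"
      by (intro K) auto
    then obtain r where "r \<in> S" "\<And>m. m < n \<Longrightarrow> r \<notin> mball (f m) e"
      by blast
    then show "\<exists>r. r \<in> S \<and> (\<forall>m<n. e \<le> d (f m) r)"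
      using sub assms(1) by (force simp: not_less)
  qed auto
  then obtain s where "\<forall>n::nat. s n \<in> S \<and> (\<forall>m<n. e \<le> d (s m) (s n))" ..
  then have s: "\<And>n. s n \<in> S" "\<And>m n. m < n \<Longrightarrow> e \<le> d (s m) (s n)"
    by simp_all
  have "e \<le> d (s m) (s n)" if "m \<noteq> n" for m n
    using s(2)[of m n] s(2)[of n m] that commute[of "s m" "s n"] by linarith
  then show thesis
    using that[of e s] e s(1) by blast
qed

section \<open>The Hausdorff distance\<close>

text \<open>Meaningful only for nonempty \<open>A\<close>, since the infimum of the empty set of
  reals carries no information; hence the nonemptiness assumptions further on.\<close>

definition set_dist :: "'a set \<Rightarrow> 'a \<Rightarrow> real" where
  "set_dist A p = (INF a\<in>A. d p a)"

text \<open>For nonempty sets this is the Hausdorff distance, in the form that makes the triangle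
  inequality immediate.\<close>
definition hausdorff_dist :: "'a set \<Rightarrow> 'a set \<Rightarrow> real" where
  "hausdorff_dist A B = (SUP p\<in>M. \<bar>set_dist A p - set_dist B p\<bar>)"

lemma bdd_below_dist: "bdd_below (d p ` A)"
  by (rule bdd_belowI[of _ 0]) auto

lemma set_dist_le: "a \<in> A \<Longrightarrow> set_dist A p \<le> d p a"
  unfolding set_dist_def by (intro cINF_lower bdd_below_dist)

lemma set_dist_nonneg: "A \<noteq> {} \<Longrightarrow> 0 \<le> set_dist A p"
  unfolding set_dist_def by (intro cINF_greatest) auto

lemma set_dist_less: "A \<noteq> {} \<Longrightarrow> set_dist A p < r \<Longrightarrow> \<exists>a\<in>A. d p a < r"
  unfolding set_dist_def by (simp add: cINF_less_iff bdd_below_dist)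

lemma set_dist_eq_0: "a \<in> A \<Longrightarrow> a \<in> M \<Longrightarrow> set_dist A a = 0"
  using set_dist_le[of a A a] set_dist_nonneg[of A a] by fastforce

lemma set_dist_eq_0_imp_in_closed:
  assumes "closedin mtopology A" "A \<noteq> {}" "p \<in> M" "set_dist A p = 0"
  shows "p \<in> A"
proof (rule ccontr)
  assume "p \<notin> A"
  then obtain r where "r > 0" "disjnt A (mball p r)"
    using assms unfolding closedin_metric by blast
  moreover obtain a where "a \<in> A" "d p a < r"
    using set_dist_less[OF assms(2), of p r] assms(4) \<open>r > 0\<close> by auto
  moreover have "a \<in> M"
    using closedin_subset[OF assms(1)] \<open>a \<in> A\<close> by auto
  ultimately show False
    using \<open>p \<in> M\<close> by (auto simp: disjnt_iff)
qed

text \<open>Going from \<open>p\<close> to \<open>a\<close> and on to a nearby point of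
  \<open>B\<close> costs at most \<open>e\<close> more than \<open>d p a\<close>; then take the
  infimum over \<open>a\<close>.\<close>

lemma set_dist_le_add:
  assumes "A \<noteq> {}" "A \<subseteq> M" "B \<subseteq> M" "p \<in> M" and near: "\<And>a. a \<in> A \<Longrightarrow> \<exists>b\<in>B. d a b \<le> e"
  shows "set_dist B p \<le> set_dist A p + e"
proof -
  have "set_dist B p - e \<le> d p a" if "a \<in> A" for a
  proof -
    obtain b where b: "b \<in> B" "d a b \<le> e"
      using near \<open>a \<in> A\<close> by blast
    have "set_dist B p \<le> d p b"
      using b by (intro set_dist_le)
    also have "\<dots> \<le> d p a + d a b"
      using assms(2,3,4) b(1) that by (intro triangle) auto
    finally show ?thesis
      using b by simp
  qed
  then have "set_dist B p - e \<le> set_dist A p"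
    using assms(1) unfolding set_dist_def[of A] by (intro cINF_greatest) auto
  then show ?thesis
    by simp
qed

text \<open>Links the supremum formula to the usual description by mutual neighbourhoods, in the
  direction used for continuity of the metric on \<open>Y\<close>. Each of the two nearness
  conditions bounds the difference of the distance functions from one side.\<close>

lemma hausdorff_dist_le:
  assumes "A \<noteq> {}" "B \<noteq> {}" "A \<subseteq> M" "B \<subseteq> M"
    and "\<And>a. a \<in> A \<Longrightarrow> \<exists>b\<in>B. d a b \<le> e" "\<And>b. b \<in> B \<Longrightarrow> \<exists>a\<in>A. d b a \<le> e"
  shows "hausdorff_dist A B \<le> e"
  unfolding hausdorff_dist_def
proof (rule cSUP_least)
  show "M \<noteq> {}"
    using assms by blast
  show "\<bar>set_dist A p - set_dist B p\<bar> \<le> e" if "p \<in> M" for p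
    using set_dist_le_add[of A B p e] set_dist_le_add[of B A p e] assms that
    by (fastforce simp: abs_le_iff)
qed

text \<open>This is the sup-norm distance between the functions \<open>set_dist (F y)\<close>,
  finite because \<open>d\<close> is bounded. The default value 0 is there because
  \<open>Metric_space\<close> demands nonnegativity and symmetry for all arguments, also outside the
  carrier.\<close>

lemma Metric_space_hausdorff_dist:
  assumes bounded: "\<And>x y. x \<in> M \<Longrightarrow> y \<in> M \<Longrightarrow> d x y \<le> 1"
    and F: "\<And>y. y \<in> S \<Longrightarrow> closedin mtopology (F y)" "\<And>y. y \<in> S \<Longrightarrow> F y \<noteq> {}" "inj_on F S"
  shows "Metric_space S (\<lambda>y z. if y \<in> S \<and> z \<in> S then hausdorff_dist (F y) (F z) else 0)"
proof -
  have FM: "F y \<subseteq> M" if "y \<in> S" for y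
    using closedin_subset[OF F(1)[OF that]] by simp
  have le1: "set_dist (F y) p \<le> 1" if y: "y \<in> S" and p: "p \<in> M" for y p
  proof -
    obtain a where "a \<in> F y"
      using F(2) y by blast
    then show ?thesis
      using set_dist_le[of a "F y" p] bounded[of p a] FM y p by force
  qed
  have bdd: "bdd_above ((\<lambda>p. \<bar>set_dist (F y) p - set_dist (F z) p\<bar>) ` M)"
    if "y \<in> S" "z \<in> S" for y z
  proof (rule bdd_aboveI2[where M = 1])
    fix p
    assume "p \<in> M"
    then show "\<bar>set_dist (F y) p - set_dist (F z) p\<bar> \<le> 1"
      using le1[OF that(1), of p] le1[OF that(2), of p] set_dist_nonneg[OF F(2)[OF that(1)], of p]
        set_dist_nonneg[OF F(2)[OF that(2)], of p]
      by linarith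
  qed
  have upper: "\<bar>set_dist (F y) p - set_dist (F z) p\<bar> \<le> hausdorff_dist (F y) (F z)"
    if "y \<in> S" "z \<in> S" "p \<in> M" for y z p
    unfolding hausdorff_dist_def using that by (intro cSUP_upper bdd)
  \<comment> \<open>A supremum over an empty \<open>M\<close> would have no usable value.\<close>
  have M: "M \<noteq> {}" if "y \<in> S" for y
    using F(2) FM that by blast
  have nonneg: "0 \<le> hausdorff_dist (F y) (F z)" if "y \<in> S" "z \<in> S" for y z
    using upper[OF that] M[OF that(1)] by (metis abs_ge_zero ex_in_conv order_trans)
  \<comment> \<open>At \<open>a\<close> in \<open>F y\<close> the first distance function vanishes,
    so the second does too, and closedness of \<open>F z\<close> gives membership.\<close>
  have sub: "F y \<subseteq> F z" if y: "y \<in> S" and z: "z \<in> S" and 0: "hausdorff_dist (F y) (F z) = 0" for y z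
  proof
    fix a
    assume a: "a \<in> F y"
    then have "a \<in> M"
      using FM y by blast
    then have "set_dist (F z) a = 0"
      using upper[OF y z, of a] set_dist_eq_0[OF a] 0 by simp
    then show "a \<in> F z"
      using set_dist_eq_0_imp_in_closed[OF F(1)[OF z] F(2)[OF z] \<open>a \<in> M\<close>] by simp
  qed
  have comm: "hausdorff_dist A B = hausdorff_dist B A" for A B
    unfolding hausdorff_dist_def by (simp add: abs_minus_commute)
  show ?thesis
  proof
    fix y z
    assume y: "y \<in> S" and z: "z \<in> S"
    have "hausdorff_dist (F y) (F y) = 0"
      unfolding hausdorff_dist_def using M[OF y] by simp
    moreover have "y = z" if "hausdorff_dist (F y) (F z) = 0"
      using sub[OF y z] sub[OF z y] that comm[of "F y" "F z"] F(3) y z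
      by (metis inj_onD subset_antisym)
    ultimately show "((if y \<in> S \<and> z \<in> S then hausdorff_dist (F y) (F z) else 0) = 0) = (y = z)"
      using y z by auto
  next
    fix x y z
    assume x: "x \<in> S" and y: "y \<in> S" and z: "z \<in> S"
    have "hausdorff_dist (F x) (F z) \<le> hausdorff_dist (F x) (F y) + hausdorff_dist (F y) (F z)"
      unfolding hausdorff_dist_def[of "F x" "F z"]
    proof (rule cSUP_least)
      show "M \<noteq> {}"
        using M x by blast
      show "\<bar>set_dist (F x) p - set_dist (F z) p\<bar>
          \<le> hausdorff_dist (F x) (F y) + hausdorff_dist (F y) (F z)" if "p \<in> M" for p
        using upper[OF x y that] upper[OF y z that] by linarith
    qed
    then show "(if x \<in> S \<and> z \<in> S then hausdorff_dist (F x) (F z) else 0)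
        \<le> (if x \<in> S \<and> y \<in> S then hausdorff_dist (F x) (F y) else 0)
          + (if y \<in> S \<and> z \<in> S then hausdorff_dist (F y) (F z) else 0)"
      using x y z by simp
  qed (auto simp: nonneg comm)
qed

end

section \<open>The metric on \<open>Y\<close> and its continuity\<close>

text \<open>Openness of \<open>f\<close> makes the fibre over a nearby point come close to any given
  point of \<open>F y\<close>; total boundedness lets finitely many such points suffice. Closedness
  of \<open>f\<close> keeps nearby fibres inside a uniform neighbourhood of
  \<open>F y\<close>.\<close>

lemma submetrizable_image_totally_bounded_fibres:
  assumes "Metric_space M d" and bounded: "\<And>x y. x \<in> M \<Longrightarrow> y \<in> M \<Longrightarrow> d x y \<le> 1"
    and M: "M = topspace X" and coarser: "\<And>U. openin (Metric_space.mtopology M d) U \<Longrightarrow> openin X U"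
    and f: "open_map X Y f" "closed_map X Y f" "f ` topspace X = topspace Y"
    and fib: "\<And>y. y \<in> topspace Y \<Longrightarrow> closedin (Metric_space.mtopology M d) {x \<in> M. f x = y}"
      "\<And>y. y \<in> topspace Y \<Longrightarrow> Metric_space.mtotally_bounded M d {x \<in> M. f x = y}"
  shows "submetrizable_space Y"
proof -
  interpret Metric_space M d by fact
  define F where "F y = {x \<in> M. f x = y}" for y
  define \<rho> where "\<rho> y z = (if y \<in> topspace Y \<and> z \<in> topspace Y
                            then hausdorff_dist (F y) (F z) else 0)" for y z
  have ne: "F y \<noteq> {}" if "y \<in> topspace Y" for y
    using that unfolding F_def M f(3)[symmetric] by auto
  have "inj_on F (topspace Y)"
    using ne unfolding inj_on_def F_def by blast
  then have "Metric_space (topspace Y) \<rho>"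
    unfolding \<rho>_def using bounded fib(1)[folded F_def] ne
    by (intro Metric_space_hausdorff_dist) auto
  then interpret R: Metric_space "topspace Y" \<rho> .
  have "openin Y U" if U: "openin R.mtopology U" for U
  proof (subst openin_subopen, intro ballI)
    fix y
    assume "y \<in> U"
    then obtain r where r: "r > 0" "R.mball y r \<subseteq> U" and y: "y \<in> topspace Y"
      using U unfolding R.openin_mtopology by blast
    \<comment> \<open>The Hausdorff estimate is only non-strict, so \<open>e\<close> must lie
      strictly below \<open>r\<close>.\<close>
    define e where "e = r / 2"
    have e: "e > 0" "e < r"
      using r by (auto simp: e_def)
    \<comment> \<open>Radius \<open>e/2\<close> makes any two points of the same ball less than
      \<open>e\<close> apart.\<close>
    obtain K where K: "finite K" "K \<subseteq> F y" "F y \<subseteq> (\<Union>k\<in>K. mball k (e/2))"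
      using fib(2)[OF y] e unfolding mtotally_bounded_def F_def
      by (meson half_gt_zero)
    define N where "N = (\<Union>a\<in>F y. mball a e)"
    have "openin X N"
      unfolding N_def by (intro coarser openin_Union) auto
    then have "closedin X (topspace X - N)"
      by blast
    then have clo: "closedin Y (f ` (topspace X - N))"
      using f closed_map_def by blast
    have opn: "openin Y (f ` mball k (e/2))" for k
      using f coarser openin_mball open_map_def by metis
    \<comment> \<open>For \<open>z\<close> in \<open>W\<close>, the first factor says that the fibre
      over \<open>z\<close> meets every ball of the finite net, the second that this fibre lies in
      \<open>N\<close>. These give the two halves of the Hausdorff estimate.\<close>
    define W where "W = (\<Inter>k\<in>K. f ` mball k (e/2)) \<inter> (topspace Y - f ` (topspace X - N))"
    have "K \<noteq> {}"
      using K ne[OF y] by auto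
    then have "openin Y W"
      unfolding W_def using K opn clo by (intro openin_Int openin_INT2) auto
    moreover have "y \<in> W"
    proof -
      have "y \<in> f ` mball k (e/2)" if "k \<in> K" for k
        using K that e by (intro image_eqI[of _ _ k]) (auto simp: F_def)
      moreover have "y \<notin> f ` (topspace X - N)"
        using e(1) unfolding N_def F_def M[symmetric] by auto
      ultimately show ?thesis
        unfolding W_def using y by blast
    qed
    moreover have "W \<subseteq> U"
    proof
      fix z
      assume zW: "z \<in> W"
      then have z: "z \<in> topspace Y"
        unfolding W_def by blast
      have "hausdorff_dist (F y) (F z) \<le> e"
      proof (rule hausdorff_dist_le)
        fix a
        assume a: "a \<in> F y"
        then obtain k where k: "k \<in> K" "a \<in> mball k (e/2)"
          using K by blast
        then have "z \<in> f ` mball k (e/2)"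
          using zW unfolding W_def by blast
        then obtain b where b: "z = f b" "b \<in> mball k (e/2)"
          by blast
        then have "d a b \<le> e"
          using k triangle''[of a k b] by auto
        then show "\<exists>b\<in>F z. d a b \<le> e"
          using b unfolding F_def by auto
      next
        fix b
        assume b: "b \<in> F z"
        then have "b \<in> N"
          using zW M unfolding W_def F_def by blast
        then obtain a where "a \<in> F y" "d a b < e"
          unfolding N_def by auto
        then show "\<exists>a\<in>F y. d b a \<le> e"
          by (auto simp: commute intro!: bexI[of _ a])
      qed (use ne y z in \<open>auto simp: F_def\<close>)
      then have "z \<in> R.mball y r"
        using y z e unfolding R.in_mball \<rho>_def by simp
      then show "z \<in> U"
        using r by blast
    qed
    ultimately show "\<exists>T. openin Y T \<and> y \<in> T \<and> T \<subseteq> U"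
      by blast
  qed
  then show ?thesis
    unfolding submetrizable_space_def
    using R.metrizable_space_mtopology R.topspace_mtopology by blast
qed

section \<open>Fibres are totally bounded and closed\<close>

theorem theorem26:
  fixes X :: "'a topology" and Y :: "'b topology" and f :: "'a \<Rightarrow> 'b"
  assumes "submetrizable_space X"
    and "functionally_Hausdorff_space Y"
    and "dense_in_itself_space Y"
    and "\<forall>y \<in> topspace Y. \<exists>Q. Q \<subseteq> topspace Y \<and> y \<in> Q \<and>
           q_point_of y (subtopology Y Q) \<and> \<not> isolated_point_of y (subtopology Y Q)"
    and "continuous_map X Y f"
    and "f ` topspace X = topspace Y"
    and "open_map X Y f"
    and "closed_map X Y f"
  shows "submetrizable_space Y"
proof -
  obtain M' d' where md': "Metric_space M' d'" "topspace X = M'"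
    and coarser': "\<And>U. openin (Metric_space.mtopology M' d') U \<Longrightarrow> openin X U"
    using assms(1) unfolding submetrizable_space_def metrizable_space_def
    by (metis Metric_space.topspace_mtopology)
  define M where "M = topspace X"
  \<comment> \<open>Capping at 1 leaves the metric topology unchanged and gives the bound that the
    Hausdorff distance needs.\<close>
  define d where "d = Metric_space.capped_dist d' 1"
  have md: "Metric_space M d"
    using md' unfolding M_def d_def by (simp add: Metric_space.capped_dist)
  have d1: "d x y \<le> 1" for x y
    using md'(1) unfolding d_def by (simp add: Metric_space.capped_dist_def)
  have coarser: "openin X U" if "openin (Metric_space.mtopology M d) U" for U
    using that md' coarser' unfolding M_def d_def by (simp add: Metric_space.mtopology_capped_metric)
  interpret Metric_space M d by (rule md)
  have t1: "t1_space X" "t1_space Y"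
    using assms submetrizable_imp_t1_space functionally_Hausdorff_imp_t1_space by auto
  have misses: "\<exists>n. y \<notin> f ` V n"
    if "y \<in> topspace Y" "\<And>n::nat. openin X (V n)"
      "\<And>x. x \<in> topspace X \<Longrightarrow> \<exists>W. openin X W \<and> x \<in> W \<and> finite {n. V n \<inter> W \<noteq> {}}" for y V
    using locally_finite_open_sequence_misses_fibre[OF t1 assms(7,8) _ _ that(2,3)] assms(4) that(1)
    by blast
  have tb: "mtotally_bounded {x \<in> M. f x = y}" if y: "y \<in> topspace Y" for y
  proof (rule ccontr)
    assume "\<not> mtotally_bounded {x \<in> M. f x = y}"
    then obtain e s where e: "e > 0" and s: "range s \<subseteq> {x \<in> M. f x = y}"
      and sep: "\<And>m n::nat. m \<noteq> n \<Longrightarrow> e \<le> d (s m) (s n)"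
      using not_mtotally_bounded_imp_separated_sequence[of "{x \<in> M. f x = y}"] by blast
    have sM: "s n \<in> M" "f (s n) = y" for n
      using s by auto
    have "\<exists>n. y \<notin> f ` mball (s n) (e/4)"
    proof (rule misses[OF y])
      show "openin X (mball (s n) (e/4))" for n
        by (intro coarser openin_mball)
      fix x
      assume "x \<in> topspace X"
      then have x: "x \<in> M"
        by (simp add: M_def)
      \<comment> \<open>The radii \<open>e/4\<close> are chosen so that a ball meeting the one
        around \<open>x\<close> has its centre within \<open>e/2\<close> of
        \<open>x\<close>.\<close>
      have near: "d (s n) x < e/2" if "mball (s n) (e/4) \<inter> mball x (e/4) \<noteq> {}" for n
      proof -
        obtain p where "p \<in> M" "d (s n) p < e/4" "d x p < e/4"
          using \<open>mball (s n) (e/4) \<inter> mball x (e/4) \<noteq> {}\<close> by auto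
        then show ?thesis
          using triangle'[of "s n" p x] triangle[of "s n" p x] commute[of x p] x sM by simp
      qed
      \<comment> \<open>Two such centres would be less than \<open>e\<close> apart, so the ball
        around \<open>x\<close> meets at most one ball of the sequence.\<close>
      have "m = n" if "d (s m) x < e/2" "d (s n) x < e/2" for m n
        using sep[of m n] triangle''[of "s m" x "s n"] triangle[of "s m" x "s n"]
          commute[of x "s n"] that x sM by fastforce
      then have "is_singleton {n. mball (s n) (e/4) \<inter> mball x (e/4) \<noteq> {}}
          \<or> {n. mball (s n) (e/4) \<inter> mball x (e/4) \<noteq> {}} = {}"
        using near unfolding is_singleton_def by blast
      then have "finite {n. mball (s n) (e/4) \<inter> mball x (e/4) \<noteq> {}}"
        by (metis finite.emptyI finite.insertI is_singleton_def)
      then show "\<exists>W. openin X W \<and> x \<in> W \<and> finite {n. mball (s n) (e/4) \<inter> W \<noteq> {}}"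
        using x e by (intro exI[of _ "mball x (e/4)"]) (auto intro: coarser)
    qed
    \<comment> \<open>Every ball contains its own centre, which lies over \<open>y\<close>.\<close>
    then show False
      using sM e by (force simp: image_iff)
  qed
  have cl: "closedin mtopology {x \<in> M. f x = y}" if y: "y \<in> topspace Y" for y
    unfolding closedin_metric
  proof (intro conjI allI impI)
    fix x
    assume "x \<in> M - {x \<in> M. f x = y}"
    then have x: "x \<in> M" "f x \<noteq> y"
      by auto
    then have "f x \<in> topspace Y"
      using assms(6) M_def by blast
    then obtain h where h: "continuous_map Y (top_of_set {0..1}) h" "h y = 0" "h (f x) = (1::real)"
      using assms(2) y x(2) unfolding functionally_Hausdorff_space_def by metis
    have h0: "0 \<le> h z" if "z \<in> topspace Y" for z
      using h(1) that unfolding continuous_map_in_subtopology by auto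
    \<comment> \<open>\<open>\<phi>\<close> vanishes nowhere, but tends to 0 along points of the fibre over \<open>y\<close> that approach \<open>x\<close>.\<close>
    define \<phi> where "\<phi> z = d x z + h (f z)" for z
    have "continuous_map X euclideanreal (d x)"
      using continuous_map_dist[OF x(1)] coarser
      unfolding continuous_map topspace_mtopology M_def[symmetric] by simp
    moreover have "continuous_map X euclideanreal (h \<circ> f)"
      using h(1) assms(5) continuous_map_compose continuous_map_into_fulltopology by blast
    ultimately have cont: "continuous_map X euclideanreal \<phi>"
      unfolding \<phi>_def by (intro continuous_map_add) (auto simp: o_def)
    \<comment> \<open>At \<open>x\<close> the second summand is 1; elsewhere \<open>d x z\<close> is
      already positive.\<close>
    have pos: "0 < \<phi> z" if "z \<in> M" for z
    proof (cases "z = x")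
      case True
      then show ?thesis
        using h x unfolding \<phi>_def by simp
    next
      case False
      then have "0 < d x z"
        using x that by simp
      moreover have "f z \<in> topspace Y"
        using assms(6) that M_def by blast
      ultimately show ?thesis
        using h0 unfolding \<phi>_def by (simp add: add_pos_nonneg)
    qed
    have "\<exists>n. y \<notin> f ` {z \<in> topspace X. \<phi> z < inverse (Suc n)}"
    proof (rule misses[OF y])
      show "openin X {z \<in> topspace X. \<phi> z < inverse (Suc n)}" for n
        by (intro continuous_map_openin_Collect_less cont)
      fix z
      assume z: "z \<in> topspace X"
      \<comment> \<open>On \<open>W\<close> the function \<phi> stays above half its positive value
        at \<open>z\<close>, so only the finitely many indices with \<open>inverse (Suc n)\<close>
        above that half can contribute.\<close>
      define W where "W = {w \<in> topspace X. \<phi> z / 2 < \<phi> w}"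
      obtain k where k: "inverse (Suc k) < \<phi> z / 2"
        using reals_Archimedean[of "\<phi> z / 2"] pos z M_def by auto
      have "n < k" if ne: "{z \<in> topspace X. \<phi> z < inverse (Suc n)} \<inter> W \<noteq> {}" for n
      proof (rule ccontr)
        assume "\<not> n < k"
        then have "inverse (real (Suc n)) \<le> inverse (real (Suc k))"
          by (intro le_imp_inverse_le) auto
        moreover obtain w where "\<phi> w < inverse (real (Suc n))" "\<phi> z / 2 < \<phi> w"
          using ne unfolding W_def by blast
        ultimately show False
          using k by linarith
      qed
      then have "finite {n. {z \<in> topspace X. \<phi> z < inverse (Suc n)} \<inter> W \<noteq> {}}"
        by (metis (mono_tags, lifting) finite_nat_set_iff_bounded mem_Collect_eq)
      moreover have "openin X W"
        unfolding W_def by (intro continuous_map_openin_Collect_greater cont)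
      moreover have "z \<in> W"
        using z pos[of z] unfolding W_def M_def by simp
      ultimately show "\<exists>W. openin X W \<and> z \<in> W \<and>
          finite {n. {z \<in> topspace X. \<phi> z < inverse (Suc n)} \<inter> W \<noteq> {}}"
        by blast
    qed
    then obtain n where n: "y \<notin> f ` {z \<in> topspace X. \<phi> z < inverse (Suc n)}"
      by blast
    \<comment> \<open>On the fibre over \<open>y\<close> the term \<open>h (f z)\<close> is 0, so
      \<phi> equals \<open>d x\<close> there, and missing the sublevel set means staying outside the
      ball around \<open>x\<close>.\<close>
    have "disjnt {x \<in> M. f x = y} (mball x (inverse (Suc n)))"
      using n h(2) unfolding disjnt_iff \<phi>_def M_def[symmetric] by auto
    then show "\<exists>r>0. disjnt {x \<in> M. f x = y} (mball x r)"
      by (intro exI[of _ "inverse (Suc n)"]) auto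
  qed auto
  show ?thesis
    using submetrizable_image_totally_bounded_fibres[OF md d1 M_def coarser assms(7,8,6) cl tb] .
qed

end
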